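(* Let $U_1,\dots,U_m\subset\mathbb{R}^n$ be nonempty closed convex sets with $U:=\bigcap_{i=1}^m U_i\neq\emptyset$, and let $(\varepsilon_k)_{k\ge1}\subset[0,1)$ satisfy $\sup_k\varepsilon_k<1$. For any starting point $x_1\in\mathbb{R}^n$, any sequence $(x_k)_{k\ge1}$ generated by A3PM with accuracies $(\varepsilon_k)$ converges to a point $\bar x\in U$.
   Context: $\mathbb{R}^n$ carries the Euclidean inner product and norm, and $\operatorname{dist}(x,C)=\inf_{y\in C}\|x-y\|$. Approximate projection: for a nonempty closed convex set $X\subset\mathbb{R}^n$, $\varepsilon\in[0,1)$ and $x\in\mathbb{R}^n$, an approximate projection $\widehat P_X(x,\varepsilon)$ of $x$ onto $X$ with accuracy $\varepsilon$ is any point $\widehat x\in\mathbb{R}^n$ such that (i) $\operatorname{dist}(\widehat x,X)\le\varepsilon\operatorname{dist}(x,X)$ and (ii) $X\subset\{z:\langle z-\widehat x,\,x-\widehat x\rangle\le0\}$. A sequence generated by A3PM (Approximate Parallel Polyhedral Projection Method) with accuracies $(\varepsilon_k)$ from $x_1$ is any sequence such that for every $k\ge1$ there are approximate projections $\widehat P_{U_i}(x_k,\varepsilon_k)$ of $x_k$ onto $U_i$ ($i=1,\dots,m$) for which, with $$\widehat S_{ik}=\{z:\langle x_k-\widehat P_{U_i}(x_k,\varepsilon_k),\,z-\widehat P_{U_i}(x_k,\varepsilon_k)\rangle\le0\},\qquad \widehat\Omega_k=\bigcap_{i=1}^m\widehat S_{ik},$$ $x_{k+1}$ is an approximate projection of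 $x_k$ onto $\widehat\Omega_k$ with accuracy $\varepsilon_k$, i.e. $x_{k+1}=\widehat P_{\widehat\Omega_k}(x_k,\varepsilon_k)$. *)

theory Defs
  imports "HOL-Analysis.Analysis"
begin

text \<open>
  \<open>approx_projection X e x y\<close> says that \<open>y\<close> is an approximate projection of \<open>x\<close> onto \<open>X\<close>
  with accuracy \<open>e\<close>. The notion is meant for \<open>X\<close> nonempty, closed and convex and for
  \<open>e\<close> in \<open>[0,1)\<close>: the library sets \<^term>\<open>infdist x {} = 0\<close>.
\<close>
definition approx_projection :: "'a::real_inner set \<Rightarrow> real \<Rightarrow> 'a \<Rightarrow> 'a \<Rightarrow> bool" where
  "approx_projection X e x y \<longleftrightarrow>
     infdist y X \<le> e * infdist x X \<and> X \<subseteq> {z. inner (z - y) (x - y) \<le> 0}"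

text \<open>A half-space, or the whole space if \<open>p = x\<close>.\<close>
definition separating_halfspace :: "'a::real_inner \<Rightarrow> 'a \<Rightarrow> 'a set" where
  "separating_halfspace x p = {z. inner (x - p) (z - p) \<le> 0}"

text \<open>
  Sequences are indexed from \<open>1\<close>; the value \<open>x 0\<close> is irrelevant. The approximate
  projections \<open>p i\<close> may be chosen afresh in every step \<open>k\<close>. The intersection of the half-spaces
  is closed and convex, and it contains every common point of \<open>U 1\<close>, ..., \<open>U m\<close>; so it is
  nonempty, as \<^const>\<open>approx_projection\<close> needs, as soon as these sets have a common point.
\<close>
definition A3PM_sequence ::
  "nat \<Rightarrow> (nat \<Rightarrow> 'a::real_inner set) \<Rightarrow> (nat \<Rightarrow> real) \<Rightarrow> 'a \<Rightarrow> (nat \<Rightarrow> 'a) \<Rightarrow> bool" where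
  "A3PM_sequence m U e x1 x \<longleftrightarrow>
     x 1 = x1 \<and>
     (\<forall>k\<ge>1. \<exists>p. (\<forall>i\<in>{1..m}. approx_projection (U i) (e k) (x k) (p i)) \<and>
        approx_projection (\<Inter>i\<in>{1..m}. separating_halfspace (x k) (p i)) (e k) (x k) (x (Suc k)))"

end

theory Submission
  imports Defs
begin

text \<open>
  Every point of \<open>U\<close> lies in all polyhedra \<open>\<Omega>\<^sub>k\<close>, so the sequence is Fejer monotone with respect to
  \<open>U\<close>, with gain \<open>\<parallel>x\<^sub>k - x\<^sub>k\<^sub>+\<^sub>1\<parallel>\<^sup>2\<close>; hence the steps tend to \<open>0\<close>. An approximate projection moves its
  point by at least \<open>1 - \<epsilon>\<close> times the distance to the set. Applying this to \<open>\<Omega>\<^sub>k\<close> and then to \<open>U\<^sub>i\<close>,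
  whose projection step is exactly the distance to the half-space containing \<open>\<Omega>\<^sub>k\<close>, bounds
  \<open>(1 - \<epsilon>)\<^sup>2 dist(x\<^sub>k, U\<^sub>i)\<close> by the step length. So cluster points lie in \<open>U\<close>, and Fejer monotonicity
  turns the convergence of a subsequence into that of the whole sequence.
\<close>

text \<open>Triangle inequality for \<open>infdist\<close>. The accuracy \<open>e\<close> is relaxed
  to a bound \<open>E\<close> so that one factor \<open>1 - E\<close> can serve all steps.\<close>

lemma approx_projection_infdist_le:
  assumes "approx_projection X e x y" and "X \<noteq> {}" and "e \<le> E"
  shows "(1 - E) * infdist x X \<le> dist x y"
proof -
  have "infdist x X \<le> infdist y X + dist x y"
    by (rule infdist_triangle)
  also have "infdist y X \<le> e * infdist x X"
    using assms(1) by (simp add: approx_projection_def)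
  also have "e * infdist x X \<le> E * infdist x X"
    using assms(3) by (intro mult_right_mono infdist_nonneg)
  finally show ?thesis
    by (simp add: algebra_simps)
qed

text \<open>The angle at \<open>y\<close> in the triangle \<open>x\<close>, \<open>y\<close>,
  \<open>u\<close> is not acute, so the law of cosines applies.\<close>

lemma approx_projection_dist_le:
  assumes "approx_projection X e x y" and "u \<in> X"
  shows "(dist y u)\<^sup>2 + (dist x y)\<^sup>2 \<le> (dist x u)\<^sup>2"
proof -
  have "inner (u - y) (x - y) \<le> 0"
    using assms by (auto simp: approx_projection_def)
  then show ?thesis
    by (simp add: dist_norm power2_norm_eq_inner inner_diff_left inner_diff_right inner_commute)
qed

lemma approx_projection_subset_separating_halfspace:
  assumes "approx_projection X e x p"
  shows "X \<subseteq> separating_halfspace x p"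
  using assms by (auto simp: approx_projection_def separating_halfspace_def inner_commute)

text \<open>Cauchy-Schwarz: \<open>p\<close> is the exact projection of \<open>x\<close> onto the
  half-space.\<close>

lemma dist_le_separating_halfspace:
  assumes "z \<in> separating_halfspace x p"
  shows "dist x p \<le> dist x z"
proof (cases "x = p")
  case False
  have "norm (x - p) * norm (x - p) = inner (x - p) (x - p)"
    by (simp add: power2_norm_eq_inner flip: power2_eq_square)
  also have "\<dots> = inner (x - p) (x - z) + inner (x - p) (z - p)"
    by (simp add: inner_diff_right)
  also have "\<dots> \<le> inner (x - p) (x - z)"
    using assms by (simp add: separating_halfspace_def)
  also have "\<dots> \<le> norm (x - p) * norm (x - z)"
    by (rule norm_cauchy_schwarz)
  finally show ?thesis
    using False by (simp add: dist_norm)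
qed simp

lemma A3PM_step:
  assumes p: "\<forall>i\<in>I. approx_projection (U i) e x (p i)"
    and y: "approx_projection (\<Inter>i\<in>I. separating_halfspace x (p i)) e x y"
    and u: "u \<in> (\<Inter>i\<in>I. U i)"
    and "e \<le> E" "E < 1"
  shows "(dist y u)\<^sup>2 + (dist x y)\<^sup>2 \<le> (dist x u)\<^sup>2"
    and "i \<in> I \<Longrightarrow> infdist x (U i) \<le> dist x y / (1 - E)\<^sup>2"
proof -
  let ?\<Omega> = "\<Inter>i\<in>I. separating_halfspace x (p i)"
  have u\<Omega>: "u \<in> ?\<Omega>"
  proof
    fix i assume i: "i \<in> I"
    then have "U i \<subseteq> separating_halfspace x (p i)"
      using p by (intro approx_projection_subset_separating_halfspace[of _ e]) simp
    then show "u \<in> separating_halfspace x (p i)"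
      using u i by auto
  qed
  then show "(dist y u)\<^sup>2 + (dist x y)\<^sup>2 \<le> (dist x u)\<^sup>2"
    using y by (rule approx_projection_dist_le[rotated])
  assume i: "i \<in> I"
  have "(1 - E) * infdist x (U i) \<le> dist x (p i)"
    using p i u \<open>e \<le> E\<close> by (intro approx_projection_infdist_le[of _ e]) auto
  \<comment> \<open>Each point of \<open>?\<Omega>\<close> lies in the half-space of
    \<open>p i\<close>. The witness \<open>u\<close> matters here: for an empty set
    \<open>infdist\<close> would be 0.\<close>
  also have "\<dots> \<le> infdist x ?\<Omega>"
    using u\<Omega> i unfolding infdist_def
    by (auto intro!: cINF_greatest intro: dist_le_separating_halfspace)
  finally have "(1 - E) * ((1 - E) * infdist x (U i)) \<le> (1 - E) * infdist x ?\<Omega>"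
    using \<open>E < 1\<close> by (intro mult_left_mono) auto
  also have "\<dots> \<le> dist x y"
    using y u\<Omega> \<open>e \<le> E\<close> by (intro approx_projection_infdist_le[of _ e]) auto
  finally show "infdist x (U i) \<le> dist x y / (1 - E)\<^sup>2"
    using \<open>E < 1\<close> by (simp add: pos_le_divide_eq power2_eq_square mult_ac)
qed

text \<open>The squared distances to \<open>u\<close> decrease and are bounded below, hence
  converge; their successive differences dominate the squared steps.\<close>

lemma Fejer_steps_tendsto_0:
  fixes y :: "nat \<Rightarrow> 'a::metric_space"
  assumes "\<And>k. (dist (y (Suc k)) u)\<^sup>2 + (dist (y k) (y (Suc k)))\<^sup>2 \<le> (dist (y k) u)\<^sup>2"
  shows "(\<lambda>k. dist (y k) (y (Suc k))) \<longlonglongrightarrow> 0"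
proof -
  let ?d = "\<lambda>k. (dist (y k) u)\<^sup>2"
  have "decseq ?d"
    using assms by (intro decseq_SucI) (meson le_add_same_cancel1 order_trans zero_le_power2)
  then obtain L where L: "?d \<longlonglongrightarrow> L"
    using decseq_convergent[of ?d 0] by auto
  then have "(\<lambda>k. ?d k - ?d (Suc k)) \<longlonglongrightarrow> L - L"
    by (intro tendsto_diff LIMSEQ_Suc)
  then have "(\<lambda>k. ?d k - ?d (Suc k)) \<longlonglongrightarrow> 0"
    by simp
  then have "(\<lambda>k. (dist (y k) (y (Suc k)))\<^sup>2) \<longlonglongrightarrow> 0"
  proof (rule tendsto_sandwich[rotated 3])
    show "\<forall>\<^sub>F k in sequentially. (dist (y k) (y (Suc k)))\<^sup>2 \<le> ?d k - ?d (Suc k)"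
      using assms by (simp add: algebra_simps)
  qed auto
  then have "(\<lambda>k. sqrt ((dist (y k) (y (Suc k)))\<^sup>2)) \<longlonglongrightarrow> sqrt 0"
    by (rule tendsto_real_sqrt)
  then show ?thesis
    by simp
qed

text \<open>Monotonicity gives the distances to \<open>l\<close> a limit, and the subsequence
  identifies it as 0.\<close>

lemma decseq_dist_subseq_tendsto:
  fixes y :: "nat \<Rightarrow> 'a::metric_space"
  assumes dec: "decseq (\<lambda>k. dist (y k) l)" and "strict_mono r" and "(y \<circ> r) \<longlonglongrightarrow> l"
  shows "y \<longlonglongrightarrow> l"
proof -
  obtain L where L: "(\<lambda>k. dist (y k) l) \<longlonglongrightarrow> L"
    using decseq_convergent[OF dec, of 0] by auto
  have "(\<lambda>k. dist (y (r k)) l) \<longlonglongrightarrow> L"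
    using LIMSEQ_subseq_LIMSEQ[OF L \<open>strict_mono r\<close>] by (simp add: o_def)
  moreover have "(\<lambda>k. dist (y (r k)) l) \<longlonglongrightarrow> 0"
    using assms(3) unfolding tendsto_dist_iff[of "y \<circ> r"] by (simp add: o_def)
  ultimately have "L = 0"
    using LIMSEQ_unique by blast
  with L show ?thesis
    unfolding tendsto_dist_iff[of y] by simp
qed

lemma Fejer_convergence:
  fixes y :: "nat \<Rightarrow> 'a::heine_borel"
  assumes fejer: "\<And>u k. u \<in> (\<Inter>i\<in>I. U i) \<Longrightarrow> dist (y (Suc k)) u \<le> dist (y k) u"
    and ne: "(\<Inter>i\<in>I. U i) \<noteq> {}"
    and closed: "\<And>i. i \<in> I \<Longrightarrow> closed (U i)"
    and dist0: "\<And>i. i \<in> I \<Longrightarrow> (\<lambda>k. infdist (y k) (U i)) \<longlonglongrightarrow> 0"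
  shows "\<exists>l\<in>(\<Inter>i\<in>I. U i). y \<longlonglongrightarrow> l"
proof -
  have dec: "decseq (\<lambda>k. dist (y k) u)" if "u \<in> (\<Inter>i\<in>I. U i)" for u
    using fejer[OF that] by (rule decseq_SucI)
  obtain u where u: "u \<in> (\<Inter>i\<in>I. U i)"
    using ne by blast
  have "range y \<subseteq> cball u (dist (y 0) u)"
    using decseqD[OF dec[OF u], of 0] by (auto simp: dist_commute)
  then have "bounded (range y)"
    using bounded_cball bounded_subset by blast
  then obtain l r where r: "strict_mono r" and lim: "(y \<circ> r) \<longlonglongrightarrow> l"
    using bounded_imp_convergent_subsequence by blast
  \<comment> \<open>Monotone distances are known only for common points, so \<open>dec\<close>
    applies to \<open>l\<close> only after this.\<close>
  have "l \<in> U i" if i: "i \<in> I" for i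
  proof -
    have "(\<lambda>k. infdist ((y \<circ> r) k) (U i)) \<longlonglongrightarrow> infdist l (U i)"
      using lim by (rule tendsto_infdist)
    moreover have "(\<lambda>k. infdist ((y \<circ> r) k) (U i)) \<longlonglongrightarrow> 0"
      using LIMSEQ_subseq_LIMSEQ[OF dist0[OF i] r] by (simp add: o_def)
    ultimately have "infdist l (U i) = 0"
      using LIMSEQ_unique by blast
    then show ?thesis
      using in_closed_iff_infdist_zero[OF closed[OF i]] u i by blast
  qed
  then have "l \<in> (\<Inter>i\<in>I. U i)"
    by blast
  then show ?thesis
    using decseq_dist_subseq_tendsto[OF dec r lim] by blast
qed

theorem theorem3p4:
  fixes U :: "nat \<Rightarrow> (real ^ 'n) set"
    and m :: nat
    and \<epsilon> :: "nat \<Rightarrow> real"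
    and x1 :: "real ^ 'n"
    and x :: "nat \<Rightarrow> real ^ 'n"
  assumes "\<And>i. i \<in> {1..m} \<Longrightarrow> U i \<noteq> {} \<and> closed (U i) \<and> convex (U i)"
    and "(\<Inter>i\<in>{1..m}. U i) \<noteq> {}"
    and "\<And>k. k \<ge> 1 \<Longrightarrow> \<epsilon> k \<in> {0..<1}"
    and "(SUP k\<in>{1..}. \<epsilon> k) < 1"
    and "A3PM_sequence m U \<epsilon> x1 x"
  shows "\<exists>xbar \<in> (\<Inter>i\<in>{1..m}. U i). x \<longlonglongrightarrow> xbar"
proof -
  define E where "E = (SUP k\<in>{1..}. \<epsilon> k)"
  \<comment> \<open>The shift discards \<open>x 0\<close>, which is arbitrary and may violate
    monotonicity.\<close>
  define y where "y k = x (Suc k)" for k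
  have E: "E < 1"
    using assms(4) by (simp add: E_def)
  \<comment> \<open>A real \<open>SUP\<close> is known to be an upper bound only for a set bounded
    above.\<close>
  have "bdd_above (\<epsilon> ` {1..})"
    using assms(3) by (intro bdd_aboveI2[of _ _ 1]) (simp add: less_imp_le)
  then have \<epsilon>E: "\<epsilon> (Suc k) \<le> E" for k
    unfolding E_def by (intro cSUP_upper) auto
  have step: "\<exists>p. (\<forall>i\<in>{1..m}. approx_projection (U i) (\<epsilon> (Suc k)) (y k) (p i)) \<and>
      approx_projection (\<Inter>i\<in>{1..m}. separating_halfspace (y k) (p i)) (\<epsilon> (Suc k)) (y k) (y (Suc k))"
    for k
    using assms(5) unfolding A3PM_sequence_def y_def by simp
  have gain: "(dist (y (Suc k)) u)\<^sup>2 + (dist (y k) (y (Suc k)))\<^sup>2 \<le> (dist (y k) u)\<^sup>2"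
    if "u \<in> (\<Inter>i\<in>{1..m}. U i)" for u k
    using step[of k] A3PM_step(1)[OF _ _ that \<epsilon>E E] by blast
  \<comment> \<open>This point keeps every polyhedron nonempty in \<open>near\<close> and is the
    reference point for the vanishing steps.\<close>
  obtain u where u: "u \<in> (\<Inter>i\<in>{1..m}. U i)"
    using assms(2) by blast
  have near: "infdist (y k) (U i) \<le> dist (y k) (y (Suc k)) / (1 - E)\<^sup>2" if "i \<in> {1..m}" for i k
    using step[of k] A3PM_step(2)[OF _ _ u \<epsilon>E E that] by blast
  have "\<exists>l\<in>(\<Inter>i\<in>{1..m}. U i). y \<longlonglongrightarrow> l"
  proof (rule Fejer_convergence)
    show "dist (y (Suc k)) v \<le> dist (y k) v" if "v \<in> (\<Inter>i\<in>{1..m}. U i)" for v k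
    proof (rule power2_le_imp_le)
      show "(dist (y (Suc k)) v)\<^sup>2 \<le> (dist (y k) v)\<^sup>2"
        using gain[OF that, of k] zero_le_power2[of "dist (y k) (y (Suc k))"] by linarith
    qed simp
    show "(\<lambda>k. infdist (y k) (U i)) \<longlonglongrightarrow> 0" if "i \<in> {1..m}" for i
    proof (rule tendsto_sandwich[OF _ _ tendsto_const])
      show "(\<lambda>k. dist (y k) (y (Suc k)) / (1 - E)\<^sup>2) \<longlonglongrightarrow> 0"
        using Fejer_steps_tendsto_0[of y u, OF gain[OF u]] by (rule tendsto_divide_zero)
    qed (use near[OF that] in \<open>auto simp: infdist_nonneg\<close>)
  qed (use assms(1,2) in auto)
  then show ?thesis
    unfolding y_def using LIMSEQ_imp_Suc by blast
qed

end
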